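(* Let $\sigma=(\sigma_1,\dots,\sigma_l)$, $l\ge 2$, be a node of the PE-B\&B tree, and let $\mathcal{M}_{\sigma}=(M_1,\dots,M_l)$ be an optimal sequence of magazine configurations covering $\sigma$, computed according to the KTNS policy. Suppose that $M_{l-1}=M_l$ and $\sigma_{l-1}>\sigma_l$. Then node $\sigma$ is dominated by $\sigma'=(\sigma_1,\dots,\sigma_{l-2},\sigma_l,\sigma_{l-1})$.
   Context: Job Sequencing and Tool Switching Problem (SSP). We are given tools $T=\{1,\dots,m\}$, jobs $J=\{1,\dots,n\}$ (so jobs are compared as integers), a magazine capacity $c<m$, and for each job $j\in J$ a required toolset $T_j\subseteq T$ with $|T_j|\le c$. Every tool is required by some job: $T=\bigcup_{j\in J}T_j$. A (partial) sequence $\sigma=(\sigma_1,\dots,\sigma_l)$ consists of pairwise distinct jobs; $J_\sigma=\{\sigma_1,\dots,\sigma_l\}$ and $\overline{J}_\sigma=J\setminus J_\sigma$. A magazine configuration is a set $M\subseteq T$ with $|M|=c$. A sequence of magazine configurations $\mathcal{M}=(M_1,\dots,M_l)$ covers $\sigma$ if $T_{\sigma_i}\subseteq M_i$ for $i=1,\dots,l$. Its number of tool switches is $z(\mathcal{M})=\sum_{i=2}^{l}|M_i\setminus M_{i-1}|$ (so the initial loading is free). Let $z(\sigma)$ be the minimum of $z(\mathcal{M})$ over all $\mathcal{M}$ covering $\sigma$; a covering $\mathcal{M}$ attaining it is optimal. KTNS (Keep Tool Needed Soonest) policy. For a sequence $\sigma=(\sigma_1,\dots,\sigma_l)$, let the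 next use of tool $t$ from position $i$ be $\min\{k\ge i : t\in T_{\sigma_k}\}$, or $+\infty$ if there is no such $k$. KTNS takes $M_1$ to consist of $c$ tools with the smallest next use from position $1$ (in particular $T_{\sigma_1}\subseteq M_1$). Going from position $i$ to $i+1$, it inserts exactly the tools of $T_{\sigma_{i+1}}\setminus M_i$ and removes the same number of tools from $M_i\setminus T_{\sigma_{i+1}}$, choosing those with the largest next use from position $i+1$; ties are broken by a fixed rule. The resulting sequence of configurations is optimal for $\sigma$ (a classical fact). PE-B\&B tree. The root is the empty sequence; the children of a node $\sigma$ are the sequences obtained by appending one job of $\overline{J}_\sigma$ at the end of $\sigma$ (one child per job). Thus the nodes are all sequences of distinct jobs, and the leaves are the permutations of $J$. A completion of a node $\sigma$ is any permutation of $J$ having $\sigma$ as a prefix. The optimal value of the subproblem associated with $\sigma$ is the minimum of $z(\overline{\sigma})$ over all completions $\overline{\sigma}$ of $\sigma$. Node $\sigma$ is dominated by node $\sigma'$ if the optimal value of the subproblem associated with $\sigma'$ is not larger than that of the subproblem associated with $\sigma$. *)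

theory Defs
  imports "HOL-Library.Extended_Nat" "HOL-Library.Sublist"
    "HOL-Combinatorics.Multiset_Permutations"
begin

locale ssp =
  fixes m n c :: nat and req :: "nat \<Rightarrow> nat set"
  assumes capacity: "c < m"
    and req_subset: "j \<in> {1..n} \<Longrightarrow> req j \<subseteq> {1..m}"
    and req_card: "j \<in> {1..n} \<Longrightarrow> card (req j) \<le> c"
    and req_Union: "{1..m} = (\<Union>j\<in>{1..n}. req j)"
begin

abbreviation tools :: "nat set" where "tools \<equiv> {1..m}"

abbreviation jobs :: "nat set" where "jobs \<equiv> {1..n}"

definition configuration :: "nat set \<Rightarrow> bool" where
  "configuration M \<longleftrightarrow> M \<subseteq> tools \<and> card M = c"

definition covers :: "nat set list \<Rightarrow> nat list \<Rightarrow> bool" where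
  "covers Ms \<sigma> \<longleftrightarrow> length Ms = length \<sigma> \<and>
     (\<forall>i<length \<sigma>. configuration (Ms ! i) \<and> req (\<sigma> ! i) \<subseteq> Ms ! i)"

text \<open>List positions are counted from 0, so the first summand compares the second
  configuration with the first; the initial loading is free.\<close>

definition switches :: "nat set list \<Rightarrow> nat" where
  "switches Ms = (\<Sum>i=1..<length Ms. card (Ms ! i - Ms ! (i - 1)))"

definition seq_cost :: "nat list \<Rightarrow> nat" where
  "seq_cost \<sigma> = Min (switches ` {Ms. covers Ms \<sigma>})"

definition optimal_covering :: "nat set list \<Rightarrow> nat list \<Rightarrow> bool" where
  "optimal_covering Ms \<sigma> \<longleftrightarrow> covers Ms \<sigma> \<and> switches Ms = seq_cost \<sigma>"

text \<open>The infimum of the empty set of extended naturals is \<open>\<infinity>\<close>: a tool that is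
  not used again has next use \<open>\<infinity>\<close>.\<close>

definition next_use :: "nat list \<Rightarrow> nat \<Rightarrow> nat \<Rightarrow> enat" where
  "next_use \<sigma> i t = (INF k\<in>{k. i \<le> k \<and> k < length \<sigma> \<and> t \<in> req (\<sigma> ! k)}. enat k)"

definition ktns_init :: "nat list \<Rightarrow> nat set \<Rightarrow> bool" where
  "ktns_init \<sigma> M \<longleftrightarrow> configuration M \<and>
     (\<forall>t\<in>M. \<forall>s\<in>tools - M. next_use \<sigma> 0 t \<le> next_use \<sigma> 0 s)"

definition ktns_step :: "nat list \<Rightarrow> nat \<Rightarrow> nat set \<Rightarrow> nat set \<Rightarrow> bool" where
  "ktns_step \<sigma> i M M' \<longleftrightarrow>
     (\<exists>R \<subseteq> M - req (\<sigma> ! Suc i).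
        card R = card (req (\<sigma> ! Suc i) - M) \<and>
        (\<forall>t\<in>R. \<forall>s\<in>M - req (\<sigma> ! Suc i) - R. next_use \<sigma> (Suc i) s \<le> next_use \<sigma> (Suc i) t) \<and>
        M' = (M - R) \<union> (req (\<sigma> ! Suc i) - M))"

text \<open>No tie-breaking rule is fixed: the predicate holds for the outcome of the policy
  under every way of breaking ties, hence a statement about all \<open>Ms\<close> with
  \<open>ktns \<sigma> Ms\<close> holds for every particular rule.\<close>

definition ktns :: "nat list \<Rightarrow> nat set list \<Rightarrow> bool" where
  "ktns \<sigma> Ms \<longleftrightarrow> length Ms = length \<sigma> \<and>
     (\<sigma> \<noteq> [] \<longrightarrow> ktns_init \<sigma> (Ms ! 0)) \<and>
     (\<forall>i. Suc i < length \<sigma> \<longrightarrow> ktns_step \<sigma> i (Ms ! i) (Ms ! Suc i))"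

inductive node :: "nat list \<Rightarrow> bool" where
  root: "node []"
| child: "node \<sigma> \<Longrightarrow> j \<in> jobs - set \<sigma> \<Longrightarrow> node (\<sigma> @ [j])"

definition completions :: "nat list \<Rightarrow> nat list set" where
  "completions \<sigma> = {\<tau> \<in> permutations_of_set jobs. prefix \<sigma> \<tau>}"

definition subproblem_value :: "nat list \<Rightarrow> nat" where
  "subproblem_value \<sigma> = Min (seq_cost ` completions \<sigma>)"

definition dominated_by :: "nat list \<Rightarrow> nat list \<Rightarrow> bool" where
  "dominated_by \<sigma> \<sigma>' \<longleftrightarrow> subproblem_value \<sigma>' \<le> subproblem_value \<sigma>"

lemma node_iff: "node \<sigma> \<longleftrightarrow> distinct \<sigma> \<and> set \<sigma> \<subseteq> jobs"
proof
  show "node \<sigma> \<Longrightarrow> distinct \<sigma> \<and> set \<sigma> \<subseteq> jobs"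
    by (induction rule: node.induct) auto
  show "distinct \<sigma> \<and> set \<sigma> \<subseteq> jobs \<Longrightarrow> node \<sigma>"
    by (induction \<sigma> rule: rev_induct) (auto intro: node.intros)
qed

text \<open>Both minima above range over finite nonempty sets.\<close>

lemma finite_covers: "finite {Ms. covers Ms \<sigma>}"
proof (rule finite_subset)
  show "{Ms. covers Ms \<sigma>} \<subseteq> {Ms. set Ms \<subseteq> Pow tools \<and> length Ms = length \<sigma>}"
    by (auto simp: covers_def configuration_def set_conv_nth)
  show "finite {Ms. set Ms \<subseteq> Pow tools \<and> length Ms = length \<sigma>}"
    by (intro finite_lists_length_eq) auto
qed

lemma covers_nonempty:
  assumes "set \<sigma> \<subseteq> jobs"
  shows "{Ms. covers Ms \<sigma>} \<noteq> {}"
proof -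
  have "\<exists>M. configuration M \<and> req j \<subseteq> M" if j: "j \<in> jobs" for j
  proof -
    have "c \<le> card tools"
      using capacity by simp
    then obtain M where "req j \<subseteq> M" "M \<subseteq> tools" "card M = c"
      using exists_subset_between[OF req_card[OF j] _ req_subset[OF j] finite_atLeastAtMost] by blast
    then show ?thesis unfolding configuration_def by blast
  qed
  then obtain f where f: "\<And>j. j \<in> jobs \<Longrightarrow> configuration (f j) \<and> req j \<subseteq> f j"
    by metis
  have "covers (map f \<sigma>) \<sigma>"
    using f assms by (simp add: covers_def subset_code(1))
  then show ?thesis by blast
qed

lemma finite_completions: "finite (completions \<sigma>)"
  by (simp add: completions_def)

lemma completions_nonempty:
  assumes "node \<sigma>"
  shows "completions \<sigma> \<noteq> {}"
proof -
  obtain xs where "set xs = jobs - set \<sigma>" "distinct xs"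
    using finite_distinct_list[of "jobs - set \<sigma>"] by auto
  then have "\<sigma> @ xs \<in> completions \<sigma>"
    using assms by (auto simp: completions_def permutations_of_set_def node_iff)
  then show ?thesis by blast
qed

end

end

theory Submission
  imports Defs
begin

text \<open>
  Fix a completion \<open>\<tau>\<close> of \<open>\<sigma>\<close>, and write \<open>\<tau>'\<close> for \<open>\<tau>\<close> with the jobs at positions \<open>l - 1\<close>
  and \<open>l\<close> exchanged. It suffices to find an optimal covering \<open>K\<close> of \<open>\<tau>\<close> with
  \<open>K\<^bsub>l-1\<^esub> = K\<^bsub>l\<^esub>\<close>: this magazine then contains the tools of both jobs, so \<open>K\<close> covers \<open>\<tau>'\<close> as
  well, at the same cost. The difficulty is that the hypothesis speaks of the KTNS configurations
  \<open>M\<close> of the partial sequence \<open>\<sigma>\<close>, which may keep other tools than a run of KTNS on \<open>\<tau>\<close> does.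

  The covering \<open>K\<close> is nevertheless a run of KTNS on \<open>\<tau>\<close>. Everything rests on one potential
  inequality (\<open>ktns_potential\<close>): if \<open>K\<close> is a KTNS run and \<open>N\<close> any other covering, then for every
  position \<open>i\<close> and every threshold \<open>k\<close>, the lead that \<open>N\<close> has over \<open>K\<close> in the number of stored
  tools whose next use is at most \<open>k\<close> has been paid for by \<open>N\<close> with at least as many additional
  switches. For \<open>k = \<infinity>\<close> both numbers equal \<open>c\<close>, and the inequality says that KTNS is optimal on
  every prefix.

  Now compare \<open>K\<close> and \<open>M\<close> at position \<open>l - 1\<close>. As \<open>M\<close> is a KTNS run on \<open>\<sigma>\<close>, it has made at most
  as many switches as \<open>K\<close>. As \<open>K\<close> is a KTNS run on \<open>\<tau>\<close>, the inequality with \<open>k = l\<close> then shows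
  that \<open>K\<^bsub>l-1\<^esub>\<close> contains at least as many tools of job \<open>\<sigma>\<^bsub>l\<^esub>\<close> as \<open>M\<^bsub>l-1\<^esub>\<close> does. But
  \<open>M\<^bsub>l-1\<^esub> = M\<^bsub>l\<^esub>\<close> contains all of them, so \<open>K\<^bsub>l-1\<^esub>\<close> does too, and KTNS leaves the magazine
  unchanged in the step to position \<open>l\<close>.
\<close>

section \<open>Selecting elements with the largest keys\<close>

lemma exists_largest_subset:
  fixes f :: "'a \<Rightarrow> 'b::linorder"
  assumes "finite S" "a \<le> card S"
  shows "\<exists>R\<subseteq>S. card R = a \<and> (\<forall>t\<in>R. \<forall>s\<in>S - R. f s \<le> f t)"
  using assms(2)
proof (induction a)
  case 0
  then show ?case by (intro exI[of _ "{}"]) auto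
next
  case (Suc a)
  then obtain R where R: "R \<subseteq> S" "card R = a" "\<forall>t\<in>R. \<forall>s\<in>S - R. f s \<le> f t"
    by auto
  have finR: "finite R"
    using R(1) assms(1) finite_subset by blast
  have ne: "S - R \<noteq> {}"
  proof
    assume "S - R = {}"
    then have "S = R" using R(1) by blast
    then show False using R(2) Suc.prems by simp
  qed
  have fin: "finite (S - R)"
    using assms(1) by simp
  obtain x where x: "x \<in> S - R" "Max (f ` (S - R)) = f x"
    using fin ne by (rule obtains_MAX)
  have le: "f s \<le> f x" if "s \<in> S - R" for s
    using x(2)[symmetric] fin that by simp
  have "insert x R \<subseteq> S" using R(1) x(1) by blast
  moreover have "card (insert x R) = Suc a" using R(2) x(1) finR by simp
  moreover have "\<forall>t\<in>insert x R. \<forall>s\<in>S - insert x R. f s \<le> f t"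
    using R(3) le by blast
  ultimately show ?case by blast
qed

text \<open>
  One step of the potential argument, with the positions abstracted away: \<open>M\<close> and \<open>N\<close> are two
  magazines whose owners have paid \<open>C\<close> and \<open>C'\<close> so far, \<open>Q\<close> is the requested toolset, and \<open>f\<close> is
  the next use, which takes its least possible value \<open>q\<close> exactly on \<open>Q\<close>. The first owner discards
  a set \<open>D\<close> of tools with the largest keys, and the second moves to an arbitrary \<open>N'\<close> that contains
  \<open>Q\<close>. Let \<open>k \<ge> q\<close>. If \<open>D\<close> contains no tool with key at most \<open>k\<close>, the first owner gains as many
  such tools as are paid for, and the second cannot gain more than that. Otherwise the whole new
  magazine of the first owner has keys at most \<open>k\<close>, so the second cannot be ahead. Then, and for
  \<open>k < q\<close>, it remains to compare the payments alone: what the second owner saves on fetching \<open>Q\<close> is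
  the lead in tools of \<open>Q\<close>, which the invariant bounds at \<open>k = q\<close>.
\<close>

lemma discard_largest_potential:
  fixes f :: "'a \<Rightarrow> 'b::linorder"
  assumes fin: "finite M" "finite N" "finite N'" "finite Q"
    and card: "card N' = card M" "card Q \<le> card M"
    and Q: "\<And>t. t \<in> Q \<union> M \<union> N \<union> N' \<Longrightarrow> q \<le> f t"
      "\<And>t. t \<in> Q \<union> M \<union> N \<union> N' \<Longrightarrow> f t \<le> q \<longleftrightarrow> t \<in> Q"
    and QN': "Q \<subseteq> N'"
    and D: "D \<subseteq> M - Q" "card D = card (Q - M)" "\<forall>t\<in>D. \<forall>s\<in>M - Q - D. f s \<le> f t"
    and inv: "\<And>k. C + card {t\<in>N. f t \<le> k} \<le> C' + card {t\<in>M. f t \<le> k}"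
  shows "C + card (Q - M) + card {t\<in>N'. f t \<le> k}
      \<le> C' + card (N' - N) + card {t\<in>M - D \<union> (Q - M). f t \<le> k}"
proof -
  have finD: "finite D"
    using D(1) fin(1) finite_subset by blast
  have pay: "C + card (Q - M) \<le> C' + card (N' - N)"
  proof -
    have "{t\<in>N. f t \<le> q} = Q \<inter> N" "{t\<in>M. f t \<le> q} = Q \<inter> M"
      using Q(2) by blast+
    with inv[of q] have "C + card (Q \<inter> N) \<le> C' + card (Q \<inter> M)" by simp
    moreover have "card Q = card (Q \<inter> N) + card (Q - N)" "card Q = card (Q \<inter> M) + card (Q - M)"
      using fin(4) by (simp_all add: card_Diff_subset_Int card_mono)
    moreover have "card (Q - N) \<le> card (N' - N)"
      using QN' fin(3) by (intro card_mono) auto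
    ultimately show ?thesis by linarith
  qed
  have card_new: "card (M - D \<union> (Q - M)) = card M"
  proof -
    have "card (M - D \<union> (Q - M)) = card (M - D) + card (Q - M)"
      using fin by (intro card_Un_disjoint) auto
    moreover have "card (M - D) = card M - card D"
      using D(1) finD by (intro card_Diff_subset) auto
    moreover have "card D \<le> card M"
      using D(1) fin(1) by (intro card_mono) auto
    ultimately show ?thesis using D(2) by linarith
  qed
  consider "k < q" | "q \<le> k" "\<forall>t\<in>D. k < f t" | t where "q \<le> k" "t \<in> D" "f t \<le> k"
    by force
  then show ?thesis
  proof cases
    case 1
    then have "{t\<in>N'. f t \<le> k} = {}"
      using Q(1) by fastforce
    then show ?thesis using pay by (simp only: card.empty)
  next
    case 2
    have Qk: "f t \<le> k" if "t \<in> Q" for t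
      using Q(2)[of t] that 2(1) by force
    have "{t\<in>M - D \<union> (Q - M). f t \<le> k} = {t\<in>M. f t \<le> k} \<union> (Q - M)"
      using 2(2) Qk by fastforce
    then have "card {t\<in>M - D \<union> (Q - M). f t \<le> k} = card {t\<in>M. f t \<le> k} + card (Q - M)"
      using fin by (simp add: card_Un_disjoint disjoint_iff)
    moreover have "card {t\<in>N'. f t \<le> k} \<le> card ({t\<in>N. f t \<le> k} \<union> (N' - N))"
      using fin by (intro card_mono) auto
    moreover have "card ({t\<in>N. f t \<le> k} \<union> (N' - N)) \<le> card {t\<in>N. f t \<le> k} + card (N' - N)"
      by (rule card_Un_le)
    ultimately show ?thesis using inv[of k] by linarith
  next
    case 3
    have "f s \<le> k" if "s \<in> M - D \<union> (Q - M)" for s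
    proof (cases "s \<in> Q")
      case True
      then show ?thesis using Q(2)[of s] 3(1) by force
    next
      case False
      then show ?thesis using that D(3) 3(2,3) by force
    qed
    then have "{t\<in>M - D \<union> (Q - M). f t \<le> k} = M - D \<union> (Q - M)" by auto
    moreover have "card {t\<in>N'. f t \<le> k} \<le> card N'"
      using fin by (intro card_mono) auto
    ultimately show ?thesis using pay card card_new by simp
  qed
qed

context ssp
begin

section \<open>Next uses\<close>

lemma next_use_ge: "enat i \<le> next_use \<sigma> i t"
  unfolding next_use_def by (rule INF_greatest) simp

lemma next_use_now:
  assumes "i < length \<sigma>" "t \<in> req (\<sigma> ! i)"
  shows "next_use \<sigma> i t = enat i"
proof (rule antisym)
  show "next_use \<sigma> i t \<le> enat i"
    unfolding next_use_def using assms by (intro INF_lower) auto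
qed (rule next_use_ge)

lemma next_use_later:
  assumes "t \<notin> req (\<sigma> ! i)"
  shows "next_use \<sigma> i t = next_use \<sigma> (Suc i) t"
proof -
  have "{k. i \<le> k \<and> k < length \<sigma> \<and> t \<in> req (\<sigma> ! k)}
      = {k. Suc i \<le> k \<and> k < length \<sigma> \<and> t \<in> req (\<sigma> ! k)}"
    using assms by (auto simp: Suc_le_eq le_less)
  then show ?thesis unfolding next_use_def by simp
qed

lemma next_use_le_iff:
  assumes "i < length \<sigma>"
  shows "next_use \<sigma> i t \<le> enat i \<longleftrightarrow> t \<in> req (\<sigma> ! i)"
proof
  assume le: "next_use \<sigma> i t \<le> enat i"
  show "t \<in> req (\<sigma> ! i)"
  proof (rule ccontr)
    assume "t \<notin> req (\<sigma> ! i)"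
    then have "enat (Suc i) \<le> enat i"
      using le next_use_later next_use_ge order.trans by metis
    then show False by simp
  qed
qed (simp add: next_use_now assms)

text \<open>
  Serving job \<open>\<sigma>\<^bsub>i\<^esub>\<close> changes the next uses of its tools only, and these are present in every
  magazine that serves it. Hence comparisons between two such magazines are not affected when
  next uses are measured from one position later.
\<close>

lemma count_next_use_Suc:
  assumes i: "i < length \<sigma>" and fin: "finite M" "finite N"
    and M: "req (\<sigma> ! i) \<subseteq> M" and N: "req (\<sigma> ! i) \<subseteq> N"
    and le: "\<And>k. C + card {t\<in>N. next_use \<sigma> i t \<le> k} \<le> C' + card {t\<in>M. next_use \<sigma> i t \<le> k}"
  shows "C + card {t\<in>N. next_use \<sigma> (Suc i) t \<le> k}
      \<le> C' + card {t\<in>M. next_use \<sigma> (Suc i) t \<le> k}"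
proof -
  let ?Q = "req (\<sigma> ! i)"
  have split: "card {t\<in>S. next_use \<sigma> i' t \<le> k}
      = card {t\<in>?Q. next_use \<sigma> i' t \<le> k} + card {t\<in>S - ?Q. next_use \<sigma> i' t \<le> k}"
    if "?Q \<subseteq> S" "finite S" for S i'
  proof -
    have "{t\<in>S. next_use \<sigma> i' t \<le> k}
        = {t\<in>?Q. next_use \<sigma> i' t \<le> k} \<union> {t\<in>S - ?Q. next_use \<sigma> i' t \<le> k}"
      using that(1) by blast
    moreover have "card ({t\<in>?Q. next_use \<sigma> i' t \<le> k} \<union> {t\<in>S - ?Q. next_use \<sigma> i' t \<le> k})
        = card {t\<in>?Q. next_use \<sigma> i' t \<le> k} + card {t\<in>S - ?Q. next_use \<sigma> i' t \<le> k}"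
      using that finite_subset[OF that] by (intro card_Un_disjoint) auto
    ultimately show ?thesis by simp
  qed
  have later: "{t\<in>S - ?Q. next_use \<sigma> (Suc i) t \<le> k} = {t\<in>S - ?Q. next_use \<sigma> i t \<le> k}" for S
    using next_use_later by auto
  show ?thesis
    using le[of k] split[OF M fin(1), of i] split[OF N fin(2), of i]
      split[OF M fin(1), of "Suc i"] split[OF N fin(2), of "Suc i"]
    unfolding later by linarith
qed

section \<open>Runs of KTNS\<close>

lemma finite_req: "j \<in> jobs \<Longrightarrow> finite (req j)"
  using req_subset finite_subset by blast

lemma finite_configuration: "configuration M \<Longrightarrow> finite M"
  unfolding configuration_def using finite_subset by blast

lemma exists_ktns_init: "\<exists>M. ktns_init \<sigma> M"
proof -
  have "m - c \<le> card tools" by simp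
  then obtain R where R: "R \<subseteq> tools" "card R = m - c"
    "\<forall>t\<in>R. \<forall>s\<in>tools - R. next_use \<sigma> 0 s \<le> next_use \<sigma> 0 t"
    using exists_largest_subset[of tools "m - c" "next_use \<sigma> 0"] by auto
  have "card (tools - R) = c"
    using R capacity by (simp add: card_Diff_subset finite_subset[OF R(1)])
  then have "ktns_init \<sigma> (tools - R)"
    unfolding ktns_init_def configuration_def using R by auto
  then show ?thesis ..
qed

text \<open>
  The removal required by the policy is possible: as \<open>card Q \<le> c = card M\<close>, at least as many tools
  of \<open>M\<close> lie outside the requested set \<open>Q\<close> as tools of \<open>Q\<close> are missing from \<open>M\<close>.
\<close>

lemma exists_ktns_step:
  assumes M: "configuration M" and j: "\<sigma> ! Suc i \<in> jobs"
  shows "\<exists>M'. ktns_step \<sigma> i M M'"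
proof -
  let ?Q = "req (\<sigma> ! Suc i)"
  have fin: "finite M" "finite ?Q"
    using M j by (simp_all add: finite_configuration finite_req)
  have "card (?Q - M) + card (?Q \<inter> M) \<le> card (M - ?Q) + card (M \<inter> ?Q)"
    using fin M req_card[OF j] unfolding configuration_def
    by (simp add: card_Diff_subset_Int card_mono)
  then have "card (?Q - M) \<le> card (M - ?Q)"
    by (simp add: Int_commute)
  then show ?thesis
    using exists_largest_subset[of "M - ?Q" "card (?Q - M)" "next_use \<sigma> (Suc i)"] fin
    unfolding ktns_step_def by blast
qed

text \<open>
  A missing tool of the first job has the least next use, so all loaded tools must have it too, and
  together with the missing one they are more than the \<open>c\<close> tools that a job may require.
\<close>

lemma ktns_init_serves:
  assumes init: "ktns_init \<sigma> M" and ne: "\<sigma> \<noteq> []" and j: "\<sigma> ! 0 \<in> jobs"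
  shows "req (\<sigma> ! 0) \<subseteq> M"
proof (rule ccontr)
  assume "\<not> req (\<sigma> ! 0) \<subseteq> M"
  then obtain s where s: "s \<in> req (\<sigma> ! 0)" "s \<notin> M" by blast
  have len: "0 < length \<sigma>" using ne by simp
  have "s \<in> tools - M" using s req_subset[OF j] by blast
  then have "next_use \<sigma> 0 t \<le> enat 0" if "t \<in> M" for t
    using init that next_use_now[OF len s(1)] unfolding ktns_init_def by metis
  then have "M \<subset> req (\<sigma> ! 0)"
    using next_use_le_iff[OF len] s by blast
  then have "card M < card (req (\<sigma> ! 0))"
    using finite_req[OF j] by (intro psubset_card_mono)
  then show False
    using init req_card[OF j] unfolding ktns_init_def configuration_def by simp
qed

lemma ktns_step_configuration:
  assumes "ktns_step \<sigma> i M M'" and M: "configuration M" and j: "\<sigma> ! Suc i \<in> jobs"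
  shows "configuration M'"
proof -
  let ?Q = "req (\<sigma> ! Suc i)"
  obtain R where R: "R \<subseteq> M - ?Q" "card R = card (?Q - M)" "M' = M - R \<union> (?Q - M)"
    using assms(1) unfolding ktns_step_def by blast
  have fin: "finite M" "finite ?Q" "finite R"
    using M j finite_subset[OF R(1)] by (simp_all add: finite_configuration finite_req)
  have "card M' = card (M - R) + card (?Q - M)"
    unfolding R(3) using fin by (intro card_Un_disjoint) auto
  moreover have "card (M - R) = card M - card R"
    using R(1) fin by (intro card_Diff_subset) auto
  moreover have "card R \<le> card M"
    using R(1) fin by (intro card_mono) auto
  ultimately have "card M' = c"
    using R(2) M unfolding configuration_def by linarith
  moreover have "M' \<subseteq> tools"
    using R(3) M req_subset[OF j] unfolding configuration_def by blast
  ultimately show ?thesis unfolding configuration_def by blast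
qed

lemma ktns_step_serves: "ktns_step \<sigma> i M M' \<Longrightarrow> req (\<sigma> ! Suc i) \<subseteq> M'"
  unfolding ktns_step_def by blast

lemma ktns_step_unchanged:
  assumes "ktns_step \<sigma> i M M'" "finite M" "req (\<sigma> ! Suc i) \<subseteq> M"
  shows "M' = M"
proof -
  obtain R where R: "R \<subseteq> M - req (\<sigma> ! Suc i)" "card R = card (req (\<sigma> ! Suc i) - M)"
    "M' = M - R \<union> (req (\<sigma> ! Suc i) - M)"
    using assms(1) unfolding ktns_step_def by blast
  moreover have "req (\<sigma> ! Suc i) - M = {}" using assms(3) by blast
  moreover have "finite R" using R(1) assms(2) finite_subset by blast
  ultimately show ?thesis by simp
qed

lemma ktns_covers:
  assumes K: "ktns \<sigma> Ks" and \<sigma>: "set \<sigma> \<subseteq> jobs"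
  shows "covers Ks \<sigma>"
proof -
  have jobs: "\<sigma> ! i \<in> jobs" if "i < length \<sigma>" for i
    using \<sigma> that nth_mem by blast
  have "configuration (Ks ! i) \<and> req (\<sigma> ! i) \<subseteq> Ks ! i" if "i < length \<sigma>" for i
    using that
  proof (induction i)
    case 0
    then have "ktns_init \<sigma> (Ks ! 0)" using K unfolding ktns_def by blast
    moreover have "\<sigma> \<noteq> []" using 0 by auto
    ultimately show ?case
      using ktns_init_serves jobs[OF 0] unfolding ktns_init_def by blast
  next
    case (Suc i)
    then have "ktns_step \<sigma> i (Ks ! i) (Ks ! Suc i)" using K unfolding ktns_def by blast
    then show ?case
      using ktns_step_configuration ktns_step_serves jobs[OF Suc.prems] Suc by (meson Suc_lessD)
  qed
  then show ?thesis using K unfolding covers_def ktns_def by blast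
qed

lemma exists_ktns:
  assumes \<sigma>: "set \<sigma> \<subseteq> jobs"
  shows "\<exists>Ks. ktns \<sigma> Ks"
proof -
  have jobs: "\<sigma> ! i \<in> jobs" if "i < length \<sigma>" for i
    using \<sigma> that nth_mem by blast
  let ?P = "\<lambda>i M. (i < length \<sigma> \<longrightarrow> configuration M) \<and> (i = 0 \<longrightarrow> ktns_init \<sigma> M)"
  let ?S = "\<lambda>i M M'. Suc i < length \<sigma> \<longrightarrow> ktns_step \<sigma> i M M'"
  have "\<exists>f. \<forall>i. ?P i (f i) \<and> ?S i (f i) (f (Suc i))"
  proof (rule dependent_nat_choice)
    show "\<exists>M. ?P 0 M"
      using exists_ktns_init[of \<sigma>] unfolding ktns_init_def by blast
  next
    fix M i
    assume P: "?P i M"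
    show "\<exists>M'. ?P (Suc i) M' \<and> ?S i M M'"
    proof (cases "Suc i < length \<sigma>")
      case True
      then have M: "configuration M" using P by simp
      then obtain M' where "ktns_step \<sigma> i M M'"
        using exists_ktns_step jobs[OF True] by blast
      then show ?thesis
        using ktns_step_configuration[OF _ M jobs[OF True]] by blast
    qed auto
  qed
  then obtain f where f: "\<And>i. ?P i (f i)" "\<And>i. ?S i (f i) (f (Suc i))"
    by blast
  have "ktns \<sigma> (map f [0..<length \<sigma>])"
    unfolding ktns_def using f by auto
  then show ?thesis ..
qed

section \<open>The potential inequality and optimality of KTNS\<close>

definition switches_upto :: "nat \<Rightarrow> nat set list \<Rightarrow> nat" where
  "switches_upto i Ms = (\<Sum>j=1..<Suc i. card (Ms ! j - Ms ! (j - 1)))"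

lemma switches_upto_0: "switches_upto 0 Ms = 0"
  by (simp add: switches_upto_def)

lemma switches_upto_Suc:
  "switches_upto (Suc i) Ms = switches_upto i Ms + card (Ms ! Suc i - Ms ! i)"
  by (simp add: switches_upto_def)

lemma switches_eq_switches_upto: "Ms \<noteq> [] \<Longrightarrow> switches Ms = switches_upto (length Ms - 1) Ms"
  by (simp add: switches_def switches_upto_def)

text \<open>
  The competitor \<open>Ns\<close> is only required to serve the jobs up to position \<open>i\<close>, because it will also
  be a covering of a proper prefix of \<open>\<sigma>\<close>, whereas the policy looks ahead along all of \<open>\<sigma>\<close>.
  Next uses are measured from position \<open>Suc i\<close>, which is what the policy compares in the step that
  leaves position \<open>i\<close>.
\<close>

lemma ktns_potential:
  assumes K: "ktns \<sigma> Ks" and \<sigma>: "set \<sigma> \<subseteq> jobs"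
    and i: "i < length \<sigma>"
    and N: "\<And>j. j \<le> i \<Longrightarrow> configuration (Ns ! j) \<and> req (\<sigma> ! j) \<subseteq> Ns ! j"
  shows "switches_upto i Ks + card {t\<in>Ns ! i. next_use \<sigma> (Suc i) t \<le> k}
      \<le> switches_upto i Ns + card {t\<in>Ks ! i. next_use \<sigma> (Suc i) t \<le> k}"
  using i N
proof (induction i arbitrary: k)
  case 0
  have cK: "configuration (Ks ! 0)" "req (\<sigma> ! 0) \<subseteq> Ks ! 0"
    using ktns_covers[OF K \<sigma>] 0(1) unfolding covers_def by blast+
  have cN: "configuration (Ns ! 0)" "req (\<sigma> ! 0) \<subseteq> Ns ! 0"
    using 0(2) by blast+
  have init: "ktns_init \<sigma> (Ks ! 0)"
    using K 0(1) unfolding ktns_def by auto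
  note fin = finite_configuration[OF cK(1)] finite_configuration[OF cN(1)]
  have "card {t\<in>Ns ! 0. next_use \<sigma> 0 t \<le> k} \<le> card {t\<in>Ks ! 0. next_use \<sigma> 0 t \<le> k}" for k
  proof (cases "\<forall>t\<in>Ks ! 0. next_use \<sigma> 0 t \<le> k")
    case True
    then have "{t\<in>Ks ! 0. next_use \<sigma> 0 t \<le> k} = Ks ! 0" by blast
    moreover have "card {t\<in>Ns ! 0. next_use \<sigma> 0 t \<le> k} \<le> card (Ns ! 0)"
      using fin by (intro card_mono) auto
    ultimately show ?thesis
      using cK(1) cN(1) unfolding configuration_def by simp
  next
    case False
    \<comment> \<open>A tool left out of the initial loading is used no earlier than any loaded one, thus after \<open>k\<close>.\<close>
    then have "{t\<in>Ns ! 0. next_use \<sigma> 0 t \<le> k} \<subseteq> {t\<in>Ks ! 0. next_use \<sigma> 0 t \<le> k}"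
      using init cN(1) unfolding ktns_init_def configuration_def by (blast intro: order.trans)
    then show ?thesis using fin by (intro card_mono) auto
  qed
  then show ?case
    using count_next_use_Suc[OF 0(1) fin cK(2) cN(2), of 0 0] by (simp add: switches_upto_0)
next
  case (Suc i)
  let ?Q = "req (\<sigma> ! Suc i)"
  have j: "\<sigma> ! Suc i \<in> jobs" using Suc.prems(1) \<sigma> nth_mem by blast
  have cov: "configuration (Ks ! j) \<and> req (\<sigma> ! j) \<subseteq> Ks ! j" if "j \<le> Suc i" for j
    using ktns_covers[OF K \<sigma>] Suc.prems(1) that unfolding covers_def by simp
  have conf: "configuration (Ks ! i)" "configuration (Ks ! Suc i)"
    "configuration (Ns ! i)" "configuration (Ns ! Suc i)"
    using cov Suc.prems(2) by simp_all
  have serve: "?Q \<subseteq> Ks ! Suc i" "?Q \<subseteq> Ns ! Suc i"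
    using cov Suc.prems(2) by blast+
  note fin = conf[THEN finite_configuration]
  obtain D where D: "D \<subseteq> Ks ! i - ?Q" "card D = card (?Q - Ks ! i)"
    "\<forall>t\<in>D. \<forall>s\<in>Ks ! i - ?Q - D. next_use \<sigma> (Suc i) s \<le> next_use \<sigma> (Suc i) t"
    "Ks ! Suc i = Ks ! i - D \<union> (?Q - Ks ! i)"
    using K Suc.prems(1) unfolding ktns_def ktns_step_def by blast
  have new: "Ks ! Suc i - Ks ! i = ?Q - Ks ! i"
    using D(4) by blast
  have "switches_upto i Ks + card (?Q - Ks ! i) + card {t\<in>Ns ! Suc i. next_use \<sigma> (Suc i) t \<le> k}
      \<le> switches_upto i Ns + card (Ns ! Suc i - Ns ! i)
        + card {t\<in>Ks ! i - D \<union> (?Q - Ks ! i). next_use \<sigma> (Suc i) t \<le> k}" for k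
  proof (rule discard_largest_potential[where q = "enat (Suc i)"])
    show "card (Ns ! Suc i) = card (Ks ! i)" "card ?Q \<le> card (Ks ! i)"
      using conf req_card[OF j] unfolding configuration_def by simp_all
    show "switches_upto i Ks + card {t\<in>Ns ! i. next_use \<sigma> (Suc i) t \<le> k}
        \<le> switches_upto i Ns + card {t\<in>Ks ! i. next_use \<sigma> (Suc i) t \<le> k}" for k
      using Suc.IH Suc.prems by simp
  qed (use fin finite_req[OF j] serve D(1-3) next_use_ge next_use_le_iff[OF Suc.prems(1)] in blast)+
  then show ?case
    using count_next_use_Suc[OF Suc.prems(1) fin(2,4) serve]
    unfolding switches_upto_Suc new D(4)[symmetric] by blast
qed

lemma ktns_switches_upto_le:
  assumes K: "ktns \<sigma> Ks" and \<sigma>: "set \<sigma> \<subseteq> jobs"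
    and i: "i < length \<sigma>"
    and N: "\<And>j. j \<le> i \<Longrightarrow> configuration (Ns ! j) \<and> req (\<sigma> ! j) \<subseteq> Ns ! j"
  shows "switches_upto i Ks \<le> switches_upto i Ns"
proof -
  have "card (Ks ! i) = c" "card (Ns ! i) = c"
    using ktns_covers[OF K \<sigma>] N i unfolding covers_def configuration_def by blast+
  then show ?thesis
    using ktns_potential[OF assms, of \<infinity>] by simp
qed

lemma ktns_optimal:
  assumes K: "ktns \<sigma> Ks" and \<sigma>: "set \<sigma> \<subseteq> jobs" and ne: "\<sigma> \<noteq> []"
  shows "switches Ks = seq_cost \<sigma>"
proof -
  have len: "length Ks = length \<sigma>" using K unfolding ktns_def by blast
  have "switches Ks \<le> switches Ns" if "covers Ns \<sigma>" for Ns
  proof -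
    have lenN: "length Ns = length \<sigma>" using that unfolding covers_def by blast
    have "switches_upto (length \<sigma> - 1) Ks \<le> switches_upto (length \<sigma> - 1) Ns"
    proof (rule ktns_switches_upto_le[OF K \<sigma>])
      show "length \<sigma> - 1 < length \<sigma>" using ne by simp
      then show "configuration (Ns ! j) \<and> req (\<sigma> ! j) \<subseteq> Ns ! j" if "j \<le> length \<sigma> - 1" for j
        using \<open>covers Ns \<sigma>\<close> that unfolding covers_def by simp
    qed
    moreover have "Ks \<noteq> []" "Ns \<noteq> []" using len lenN ne by auto
    ultimately show ?thesis
      using len lenN by (simp add: switches_eq_switches_upto)
  qed
  then show ?thesis
    unfolding seq_cost_def using ktns_covers[OF K \<sigma>] finite_covers
    by (intro Min_eqI[symmetric]) auto
qed

lemma seq_cost_le: "covers Ms \<sigma> \<Longrightarrow> seq_cost \<sigma> \<le> switches Ms"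
  unfolding seq_cost_def using finite_covers by (intro Min_le) auto

section \<open>Exchanging the last two jobs\<close>

text \<open>
  That all tools of the job at position \<open>Suc p\<close> are still in the magazine at position \<open>p\<close> does not
  depend on the run of KTNS, and not even on the jobs that follow. \<open>Ms\<close> is no more expensive than
  \<open>Ks\<close> up to position \<open>p\<close>, so by the potential inequality for \<open>Ks\<close> it cannot have more of these
  tools.
\<close>

lemma ktns_extension_keeps_next_tools:
  assumes M: "ktns \<sigma> Ms" and K: "ktns (\<sigma> @ \<rho>) Ks" and jobs: "set (\<sigma> @ \<rho>) \<subseteq> jobs"
    and p: "Suc p < length \<sigma>" and kept: "req (\<sigma> ! Suc p) \<subseteq> Ms ! p"
  shows "req (\<sigma> ! Suc p) \<subseteq> Ks ! p"
proof -
  let ?Q = "req (\<sigma> ! Suc p)" and ?\<tau> = "\<sigma> @ \<rho>"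
  have \<sigma>: "set \<sigma> \<subseteq> jobs" using jobs by simp
  have nth: "?\<tau> ! j = \<sigma> ! j" if "j \<le> Suc p" for j
    using that p by (simp add: nth_append)
  have covM: "configuration (Ms ! j) \<and> req (\<sigma> ! j) \<subseteq> Ms ! j" if "j < length \<sigma>" for j
    using ktns_covers[OF M \<sigma>] that unfolding covers_def by blast
  have covK: "configuration (Ks ! j) \<and> req (?\<tau> ! j) \<subseteq> Ks ! j" if "j < length \<sigma>" for j
    using ktns_covers[OF K jobs] that unfolding covers_def by simp
  have "switches_upto p Ms \<le> switches_upto p Ks"
  proof (rule ktns_switches_upto_le[OF M \<sigma>])
    show "configuration (Ks ! j) \<and> req (\<sigma> ! j) \<subseteq> Ks ! j" if "j \<le> p" for j
      using covK[of j] nth[of j] that p by simp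
  qed (use p in simp)
  moreover have "switches_upto p Ks + card {t\<in>Ms ! p. next_use ?\<tau> (Suc p) t \<le> enat (Suc p)}
      \<le> switches_upto p Ms + card {t\<in>Ks ! p. next_use ?\<tau> (Suc p) t \<le> enat (Suc p)}"
  proof (rule ktns_potential[OF K jobs])
    show "configuration (Ms ! j) \<and> req (?\<tau> ! j) \<subseteq> Ms ! j" if "j \<le> p" for j
      using covM[of j] nth[of j] that p by simp
  qed (use p in simp)
  moreover have "{t\<in>S. next_use ?\<tau> (Suc p) t \<le> enat (Suc p)} = S \<inter> ?Q" for S
    using next_use_le_iff[of "Suc p" ?\<tau>] p nth[of "Suc p"] by auto
  ultimately have "card (Ms ! p \<inter> ?Q) \<le> card (Ks ! p \<inter> ?Q)" by simp
  moreover have "Ms ! p \<inter> ?Q = ?Q" using kept by blast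
  moreover have "finite ?Q" using \<sigma> p nth_mem finite_req by blast
  ultimately have "Ks ! p \<inter> ?Q = ?Q"
    by (intro card_seteq) auto
  then show ?thesis by blast
qed

text \<open>
  A KTNS run on the completion has the same magazine at the positions of \<open>a\<close> and \<open>b\<close>, hence covers
  both orders of the two jobs.
\<close>

lemma seq_cost_swap_le:
  assumes M: "ktns (\<pi> @ [a, b]) Ms" and jobs: "set (\<pi> @ [a, b] @ \<rho>) \<subseteq> jobs"
    and kept: "req b \<subseteq> Ms ! length \<pi>"
  shows "seq_cost (\<pi> @ [b, a] @ \<rho>) \<le> seq_cost (\<pi> @ [a, b] @ \<rho>)"
proof -
  let ?\<tau> = "\<pi> @ [a, b] @ \<rho>" and ?\<tau>' = "\<pi> @ [b, a] @ \<rho>" and ?p = "length \<pi>"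
  obtain Ks where K: "ktns ?\<tau> Ks" using exists_ktns[OF jobs] by blast
  have cov: "covers Ks ?\<tau>" by (rule ktns_covers[OF K jobs])
  have nth: "?\<tau> ! ?p = a" "?\<tau> ! Suc ?p = b" "?\<tau>' ! ?p = b" "?\<tau>' ! Suc ?p = a"
    by (simp_all add: nth_append)
  have len: "Suc ?p < length ?\<tau>" by simp
  have b: "req b \<subseteq> Ks ! ?p"
    using ktns_extension_keeps_next_tools[OF M, of \<rho> Ks ?p] K jobs kept
    by (simp add: nth_append)
  have a: "req a \<subseteq> Ks ! ?p" "finite (Ks ! ?p)"
    using cov len finite_configuration unfolding covers_def by (metis Suc_lessD nth(1))+
  have "ktns_step ?\<tau> ?p (Ks ! ?p) (Ks ! Suc ?p)"
    using K len unfolding ktns_def by blast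
  then have same: "Ks ! Suc ?p = Ks ! ?p"
    using a(2) b nth(2) by (intro ktns_step_unchanged) auto
  have "req (?\<tau>' ! i) \<subseteq> Ks ! i" if "i < length ?\<tau>'" for i
  proof -
    consider "i = ?p" | "i = Suc ?p" | "i \<noteq> ?p" "i \<noteq> Suc ?p" by blast
    then show ?thesis
    proof cases
      case 3
      then have "i < ?p \<or> Suc (Suc ?p) \<le> i" by linarith
      then have "?\<tau>' ! i = ?\<tau> ! i"
        by (auto simp: nth_append nth_Cons split: nat.split)
      then show ?thesis using cov that unfolding covers_def by simp
    qed (use a b same nth in simp_all)
  qed
  then have "covers Ks ?\<tau>'"
    using cov unfolding covers_def by simp
  then have "seq_cost ?\<tau>' \<le> switches Ks" by (rule seq_cost_le)
  also have "\<dots> = seq_cost ?\<tau>" by (rule ktns_optimal[OF K jobs]) simp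
  finally show ?thesis .
qed

lemma dominated_by_swap:
  assumes node: "node (\<pi> @ [a, b])" and M: "ktns (\<pi> @ [a, b]) Ms"
    and kept: "req b \<subseteq> Ms ! length \<pi>"
  shows "dominated_by (\<pi> @ [a, b]) (\<pi> @ [b, a])"
proof -
  have "subproblem_value (\<pi> @ [a, b]) \<in> seq_cost ` completions (\<pi> @ [a, b])"
    unfolding subproblem_value_def
    using finite_completions completions_nonempty[OF node] by (intro Min_in) auto
  then obtain \<rho> where \<rho>: "subproblem_value (\<pi> @ [a, b]) = seq_cost (\<pi> @ [a, b] @ \<rho>)"
    "\<pi> @ [a, b] @ \<rho> \<in> permutations_of_set jobs"
    unfolding completions_def by (auto elim!: prefixE)
  have "\<pi> @ [b, a] @ \<rho> \<in> completions (\<pi> @ [b, a])"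
    using \<rho>(2) unfolding completions_def permutations_of_set_def by auto
  then have "subproblem_value (\<pi> @ [b, a]) \<le> seq_cost (\<pi> @ [b, a] @ \<rho>)"
    unfolding subproblem_value_def using finite_completions by (intro Min_le) auto
  also have "\<dots> \<le> seq_cost (\<pi> @ [a, b] @ \<rho>)"
    using \<rho>(2) by (intro seq_cost_swap_le[OF M _ kept]) (simp add: permutations_of_set_def)
  finally show ?thesis unfolding dominated_by_def \<rho>(1) .
qed

end

theorem proposition5:
  fixes m n c :: nat and req :: "nat \<Rightarrow> nat set"
    and \<sigma> :: "nat list" and Ms :: "nat set list" and l :: nat
  assumes "ssp m n c req"
    and "ssp.node n \<sigma>"
    and "length \<sigma> = l" and "l \<ge> 2"
    and "ssp.optimal_covering m c req Ms \<sigma>"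
    and "ssp.ktns m c req \<sigma> Ms"
    and "Ms ! (l - 2) = Ms ! (l - 1)"
    and "\<sigma> ! (l - 2) > \<sigma> ! (l - 1)"
  shows "ssp.dominated_by m n c req \<sigma>
           (take (l - 2) \<sigma> @ [\<sigma> ! (l - 1), \<sigma> ! (l - 2)])"
proof -
  interpret ssp m n c req by (rule assms(1))
  let ?\<pi> = "take (l - 2) \<sigma>" and ?a = "\<sigma> ! (l - 2)" and ?b = "\<sigma> ! (l - 1)"
  have "drop (l - 2) \<sigma> = [?a, ?b]"
    using assms(3,4) by (intro nth_equalityI) (auto simp: less_Suc_eq numeral_2_eq_2 Suc_diff_Suc)
  then have split: "\<sigma> = ?\<pi> @ [?a, ?b]"
    by (metis append_take_drop_id)
  have len: "length ?\<pi> = l - 2" using assms(3) by simp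
  have "req ?b \<subseteq> Ms ! (l - 1)"
    using assms(3,4,5) unfolding optimal_covering_def covers_def by simp
  then have "req ?b \<subseteq> Ms ! length ?\<pi>"
    using assms(7) len by simp
  then show ?thesis
    using dominated_by_swap[of ?\<pi> ?a ?b Ms] assms(2,6) split by simp
qed

end
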